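(* Let $\mathcal{M}$ be a simple matroid polytope of rank $r$ on ground set $E$, and let $\prec$ be a K-ordering of $E$. For $\ell=0,1,\dotsc,r-1$ let $d^+_\ell(\mathcal{M})$ be the number of elements $e\in E$ whose outdegree in the digraph $G_\prec(\mathcal{M})$ equals $\ell$. Then $d^+_\ell(\mathcal{M})=h^*_\ell(\mathcal{M})$ for all $\ell=0,1,\dotsc,r-1$; in particular the numbers $d^+_\ell(\mathcal{M})$ do not depend on the choice of the K-ordering.
   Context: An oriented matroid is acyclic if it has no positive circuit. A face of an acyclic oriented matroid $\mathcal{M}$ of rank $r$ is a subset $F\subseteq E$ such that some covector $Y$ of $\mathcal{M}$ satisfies $Y\ge 0$ and $Y^0=F$; its rank is its rank in the underlying matroid. $\mathcal{M}$ is a matroid polytope if it is acyclic and every $\{e\}$, $e\in E$, is a face. The graph $G(\mathcal{M})$ has vertex set $E$ and edges the rank-2 faces $\{u,v\}$; for a face $F$, $G(F)$ is the subgraph induced on $F$. $\mathcal{M}$ is simple if every vertex of $G(\mathcal{M})$ lies on exactly $r-1$ edges. For a linear ordering $\prec$ of $E$, $G_\prec(F)$ orients each edge $\{u,v\}$ from $u$ to $v$ when $v\prec u$; a sink is a vertex of outdegree $0$; $\prec$ is a K-ordering if for every non-empty face $F$ the digraph $G_\prec(F)$ has exactly one sink. For $-1\le \ell\le r-1$, $f_\ell(\mathcal{M})$ denotes the number of faces of rank $\ell+1$ (so $f_{-1}(\mathcal{M})=f_{r-1}(\mathcal{M})=1$), and $h^*_\ell(\mathcal{M})=\sum_{i=0}^{\ell}(-1)^{\ell-i}\binom{r-1-i}{\ell-i}f_{r-1-i}(\mathcal{M})$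 for $\ell=0,\dotsc,r-1$. *)

theory Defs
  imports Complex_Main "Graph_Theory.Digraph_Component"
begin

section \<open>Oriented matroids\<close>

text \<open>
  A sign vector on \<open>E\<close> is a function with values in \<open>{-1, 0, 1}\<close>. It is required to vanish
  outside \<open>E\<close>, so that equality of functions is equality of sign vectors on \<open>E\<close>.
\<close>

definition sign_vector :: "'a set \<Rightarrow> ('a \<Rightarrow> int) \<Rightarrow> bool" where
  "sign_vector E X \<longleftrightarrow> (\<forall>e\<in>E. X e \<in> {-1, 0, 1}) \<and> (\<forall>e. e \<notin> E \<longrightarrow> X e = 0)"

definition sv_support :: "'a set \<Rightarrow> ('a \<Rightarrow> int) \<Rightarrow> 'a set" where
  "sv_support E X = {e \<in> E. X e \<noteq> 0}"

definition sv_zeros :: "'a set \<Rightarrow> ('a \<Rightarrow> int) \<Rightarrow> 'a set" where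
  "sv_zeros E X = {e \<in> E. X e = 0}"

definition sv_nonneg :: "'a set \<Rightarrow> ('a \<Rightarrow> int) \<Rightarrow> bool" where
  "sv_nonneg E X \<longleftrightarrow> (\<forall>e\<in>E. 0 \<le> X e)"

definition sv_comp :: "('a \<Rightarrow> int) \<Rightarrow> ('a \<Rightarrow> int) \<Rightarrow> 'a \<Rightarrow> int" where
  "sv_comp X Y = (\<lambda>e. if X e \<noteq> 0 then X e else Y e)"

definition sv_sep :: "'a set \<Rightarrow> ('a \<Rightarrow> int) \<Rightarrow> ('a \<Rightarrow> int) \<Rightarrow> 'a set" where
  "sv_sep E X Y = {e \<in> E. X e = - Y e \<and> X e \<noteq> 0}"

definition sv_orthogonal :: "'a set \<Rightarrow> ('a \<Rightarrow> int) \<Rightarrow> ('a \<Rightarrow> int) \<Rightarrow> bool" where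
  "sv_orthogonal E X Y \<longleftrightarrow>
     (\<forall>e\<in>E. X e * Y e = 0) \<or> ((\<exists>e\<in>E. X e * Y e > 0) \<and> (\<exists>f\<in>E. X f * Y f < 0))"

text \<open>
  An oriented matroid on the finite ground set \<open>E\<close> is given by its set \<open>L\<close> of covectors, subject to
  the covector axioms of Bjorner, Las Vergnas, Sturmfels, White and Ziegler,
  Oriented Matroids, Section 4.1.
\<close>

locale oriented_matroid =
  fixes E :: "'a set" and L :: "('a \<Rightarrow> int) set"
  assumes finite_ground: "finite E"
    and covector_sign_vector: "X \<in> L \<Longrightarrow> sign_vector E X"
    and covector_zero: "(\<lambda>e. 0) \<in> L"
    and covector_uminus: "X \<in> L \<Longrightarrow> (\<lambda>e. - X e) \<in> L"
    and covector_comp: "X \<in> L \<Longrightarrow> Y \<in> L \<Longrightarrow> sv_comp X Y \<in> L"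
    and covector_elim: "X \<in> L \<Longrightarrow> Y \<in> L \<Longrightarrow> e \<in> sv_sep E X Y \<Longrightarrow>
      \<exists>Z\<in>L. Z e = 0 \<and> (\<forall>f\<in>E - sv_sep E X Y. Z f = sv_comp X Y f)"

text \<open>
  The vectors are the sign vectors orthogonal to all covectors; the (signed) circuits are the
  non-zero vectors of inclusion-minimal support.
\<close>

definition om_vectors :: "'a set \<Rightarrow> ('a \<Rightarrow> int) set \<Rightarrow> ('a \<Rightarrow> int) set" where
  "om_vectors E L = {X. sign_vector E X \<and> (\<forall>Y\<in>L. sv_orthogonal E X Y)}"

definition om_circuits :: "'a set \<Rightarrow> ('a \<Rightarrow> int) set \<Rightarrow> ('a \<Rightarrow> int) set" where
  "om_circuits E L = {C \<in> om_vectors E L. sv_support E C \<noteq> {} \<and>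
     (\<forall>X\<in>om_vectors E L. sv_support E X \<noteq> {} \<longrightarrow> \<not> sv_support E X \<subset> sv_support E C)}"

text \<open>
  The underlying matroid has the supports of the signed circuits as its circuits. The rank of
  \<open>A\<close> is the largest size of an independent subset of \<open>A\<close>.
\<close>

definition om_indep :: "'a set \<Rightarrow> ('a \<Rightarrow> int) set \<Rightarrow> 'a set \<Rightarrow> bool" where
  "om_indep E L B \<longleftrightarrow> B \<subseteq> E \<and> \<not> (\<exists>C\<in>om_circuits E L. sv_support E C \<subseteq> B)"

definition om_rank :: "'a set \<Rightarrow> ('a \<Rightarrow> int) set \<Rightarrow> 'a set \<Rightarrow> nat" where
  "om_rank E L A = Max (card ` {B. B \<subseteq> A \<and> om_indep E L B})"

definition om_acyclic :: "'a set \<Rightarrow> ('a \<Rightarrow> int) set \<Rightarrow> bool" where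
  "om_acyclic E L \<longleftrightarrow> \<not> (\<exists>C\<in>om_circuits E L. sv_nonneg E C)"


section \<open>Matroid polytopes and their graphs\<close>

definition om_face :: "'a set \<Rightarrow> ('a \<Rightarrow> int) set \<Rightarrow> 'a set \<Rightarrow> bool" where
  "om_face E L F \<longleftrightarrow> F \<subseteq> E \<and> (\<exists>Y\<in>L. sv_nonneg E Y \<and> sv_zeros E Y = F)"

locale matroid_polytope = oriented_matroid E L
  for E :: "'a set" and L :: "('a \<Rightarrow> int) set" +
  assumes acyclic: "om_acyclic E L"
    and singleton_face: "e \<in> E \<Longrightarrow> om_face E L {e}"

definition mp_edges :: "'a set \<Rightarrow> ('a \<Rightarrow> int) set \<Rightarrow> 'a set set" where
  "mp_edges E L = {F. om_face E L F \<and> om_rank E L F = 2 \<and> (\<exists>u v. F = {u, v})}"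

text \<open>
  If \<open>E\<close> is non-empty then acyclicity gives \<open>om_rank E L E \<ge> 1\<close>, so the subtraction below does
  not truncate.
\<close>

locale simple_matroid_polytope = matroid_polytope E L
  for E :: "'a set" and L :: "('a \<Rightarrow> int) set" +
  assumes simple: "v \<in> E \<Longrightarrow> card {e \<in> mp_edges E L. v \<in> e} = om_rank E L E - 1"


section \<open>K-orderings\<close>

text \<open>
  The ordering is a strict order relation \<open>R\<close>, where \<open>(v, u) \<in> R\<close> means \<open>v \<prec> u\<close>.
  The digraph of a face \<open>F\<close> is \<open>mp_digraph E L R \<restriction> F\<close>, that of the whole polytope
  is \<open>mp_digraph E L R\<close>.
\<close>

definition mp_digraph ::
    "'a set \<Rightarrow> ('a \<Rightarrow> int) set \<Rightarrow> 'a rel \<Rightarrow> ('a, 'a \<times> 'a) pre_digraph" where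
  "mp_digraph E L R =
     \<lparr> verts = E, arcs = {(u, v). {u, v} \<in> mp_edges E L \<and> (v, u) \<in> R}, tail = fst, head = snd \<rparr>"

definition is_sink :: "('a, 'b) pre_digraph \<Rightarrow> 'a \<Rightarrow> bool" where
  "is_sink G v \<longleftrightarrow> v \<in> verts G \<and> out_degree G v = 0"

definition K_ordering :: "'a set \<Rightarrow> ('a \<Rightarrow> int) set \<Rightarrow> 'a rel \<Rightarrow> bool" where
  "K_ordering E L R \<longleftrightarrow> strict_linear_order_on E R \<and>
     (\<forall>F. om_face E L F \<and> F \<noteq> {} \<longrightarrow> (\<exists>!v. is_sink (mp_digraph E L R \<restriction> F) v))"

definition d_plus :: "'a set \<Rightarrow> ('a \<Rightarrow> int) set \<Rightarrow> 'a rel \<Rightarrow> nat \<Rightarrow> nat" where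
  "d_plus E L R l = card {e \<in> E. out_degree (mp_digraph E L R) e = l}"


section \<open>The f-vector and the h*-vector\<close>

text \<open>The index of \<open>f_number\<close> is an integer, since it starts at \<open>-1\<close>.\<close>

definition f_number :: "'a set \<Rightarrow> ('a \<Rightarrow> int) set \<Rightarrow> int \<Rightarrow> nat" where
  "f_number E L l = card {F. om_face E L F \<and> int (om_rank E L F) = l + 1}"

text \<open>Only meaningful for \<open>l < om_rank E L E\<close>; there no natural-number subtraction truncates.\<close>

definition h_star :: "'a set \<Rightarrow> ('a \<Rightarrow> int) set \<Rightarrow> nat \<Rightarrow> int" where
  "h_star E L l = (let r = om_rank E L E in
     (\<Sum>i=0..l. (-1) ^ (l - i) * int ((r - 1 - i) choose (l - i)) *
        int (f_number E L (int r - 1 - int i))))"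

end

theory Submission
  imports Defs
begin

text \<open>
  In a simple matroid polytope of rank \<open>r\<close>, the faces containing a vertex \<open>v\<close> correspond to the
  subsets of the \<open>r - 1\<close> neighbours of \<open>v\<close>, a face of rank \<open>k + 1\<close> containing \<open>k\<close> of them.
  Indeed a covector that vanishes at \<open>v\<close> and is negative somewhere is negative at a neighbour of
  \<open>v\<close>; hence \<open>v\<close> and its neighbours span, they form a basis by counting, and every sign
  pattern on this basis that is zero at \<open>v\<close> and nonnegative elsewhere comes from a nonnegative
  covector. Counting the faces of rank \<open>k + 1\<close> by their unique sink therefore gives
  \<open>f\<^sub>k = (\<Sum>v\<in>E. (r - 1 - outdeg v) choose k)\<close>, and binomial inversion yields the claim.
\<close>

section \<open>Covectors and the underlying matroid\<close>

text \<open>This is closure in the underlying matroid, since zero sets of covectors are its flats.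
  Every element outside the ground set also belongs to it, because covectors vanish there; such
  elements behave like loops.\<close>

definition cov_span :: "('a \<Rightarrow> int) set \<Rightarrow> 'a set \<Rightarrow> 'a set" where
  "cov_span L A = {e. \<forall>Y\<in>L. (\<forall>f\<in>A. Y f = 0) \<longrightarrow> Y e = 0}"

definition cov_indep :: "('a \<Rightarrow> int) set \<Rightarrow> 'a set \<Rightarrow> bool" where
  "cov_indep L B \<longleftrightarrow> (\<forall>e\<in>B. e \<notin> cov_span L (B - {e}))"

lemma in_cov_span: "e \<in> A \<Longrightarrow> e \<in> cov_span L A"
  by (simp add: cov_span_def)

lemma subset_cov_span: "A \<subseteq> cov_span L A"
  by (simp add: in_cov_span subsetI)

lemma cov_span_mono: "A \<subseteq> B \<Longrightarrow> cov_span L A \<subseteq> cov_span L B"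
  unfolding cov_span_def by blast

lemma cov_span_trans:
  assumes "A \<subseteq> cov_span L B"
  shows "cov_span L A \<subseteq> cov_span L B"
proof
  fix e assume e: "e \<in> cov_span L A"
  have "Y e = 0" if "Y \<in> L" "\<forall>f\<in>B. Y f = 0" for Y
  proof -
    have "\<forall>f\<in>A. Y f = 0" using assms that by (auto simp: cov_span_def)
    with e that show ?thesis by (simp add: cov_span_def)
  qed
  then show "e \<in> cov_span L B" by (simp add: cov_span_def)
qed

lemma cov_indep_subset: "cov_indep L B \<Longrightarrow> A \<subseteq> B \<Longrightarrow> cov_indep L A"
  unfolding cov_indep_def by (meson Diff_mono cov_span_mono in_mono order_refl)

section \<open>Elimination, exchange and independence in terms of covectors\<close>

context oriented_matroid
begin

lemma covector_values: "Y \<in> L \<Longrightarrow> Y e = -1 \<or> Y e = 0 \<or> Y e = 1"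
  using covector_sign_vector[of Y] by (cases "e \<in> E") (auto simp: sign_vector_def)

lemma covector_outside: "Y \<in> L \<Longrightarrow> e \<notin> E \<Longrightarrow> Y e = 0"
  using covector_sign_vector[of Y] by (auto simp: sign_vector_def)

text \<open>The separating set is exactly where the product of the two signs is negative. In this
  product form elimination applies to every \<open>f\<close>, inside or outside the ground set,
  without mentioning \<open>sv_sep\<close>.\<close>

lemma covector_eliminate:
  assumes X: "X \<in> L" and Y: "Y \<in> L" and neg: "X e * Y e < 0"
  obtains Z where "Z \<in> L" "Z e = 0"
    "\<And>f. X f * Y f \<ge> 0 \<Longrightarrow> Z f = (if X f \<noteq> 0 then X f else Y f)"
proof -
  have sep: "f \<in> sv_sep E X Y \<longleftrightarrow> X f * Y f < 0" for f
    using covector_values[OF X, of f] covector_values[OF Y, of f] covector_outside[OF X, of f]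
    by (cases "f \<in> E") (auto simp: sv_sep_def)
  obtain Z where Z: "Z \<in> L" "Z e = 0" "\<forall>f\<in>E - sv_sep E X Y. Z f = sv_comp X Y f"
    using covector_elim[OF X Y, of e] sep neg by blast
  have "Z f = (if X f \<noteq> 0 then X f else Y f)" if "X f * Y f \<ge> 0" for f
  proof (cases "f \<in> E")
    case True
    then have "f \<in> E - sv_sep E X Y" using sep that by auto
    then show ?thesis using Z by (auto simp: sv_comp_def)
  next
    case False
    then show ?thesis using X Y Z(1) by (simp add: covector_outside)
  qed
  with Z that show ?thesis by blast
qed

lemma not_in_cov_spanE:
  assumes "e \<notin> cov_span L A" and "s = 1 \<or> s = -1"
  obtains Y where "Y \<in> L" "\<And>f. f \<in> A \<Longrightarrow> Y f = 0" "Y e = s"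
proof -
  obtain Y where Y: "Y \<in> L" "\<forall>f\<in>A. Y f = 0" "Y e \<noteq> 0"
    using assms by (auto simp: cov_span_def)
  show ?thesis
  proof (cases "Y e = s")
    case True with Y that show ?thesis by blast
  next
    case False
    then have "- Y e = s" using Y covector_values[OF Y(1), of e] assms(2) by auto
    with Y that[OF covector_uminus[OF Y(1)]] show ?thesis by simp
  qed
qed

text \<open>The exchange property of a matroid closure. A covector \<open>Y\<close> separating
  \<open>e\<close> from \<open>A\<close> is nonzero at \<open>f\<close>; eliminating
  \<open>f\<close> against a \<open>W\<close> of opposite sign there, zero on \<open>A\<close> and
  \<open>e\<close>, would leave a covector that is zero on \<open>insert f A\<close> but not at
  \<open>e\<close>.\<close>

lemma cov_span_exchange:
  assumes e: "e \<in> cov_span L (insert f A)" "e \<notin> cov_span L A"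
  shows "f \<in> cov_span L (insert e A)"
proof (rule ccontr)
  assume f: "f \<notin> cov_span L (insert e A)"
  obtain Y where Y: "Y \<in> L" "\<And>g. g \<in> A \<Longrightarrow> Y g = 0" "Y e = 1"
    using not_in_cov_spanE[OF e(2), of 1] by auto
  then have "Y f \<noteq> 0" using e(1) by (auto simp: cov_span_def)
  then have "- Y f = 1 \<or> - Y f = -1" using covector_values[OF Y(1), of f] by auto
  then obtain W where W: "W \<in> L" "\<And>g. g \<in> insert e A \<Longrightarrow> W g = 0" "W f = - Y f"
    using not_in_cov_spanE[OF f] by metis
  have "Y f * W f < 0" using W \<open>Y f \<noteq> 0\<close> covector_values[OF Y(1), of f] by auto
  from covector_eliminate[OF Y(1) W(1) this] obtain Z where Z: "Z \<in> L" "Z f = 0"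
    "\<And>g. Y g * W g \<ge> 0 \<Longrightarrow> Z g = (if Y g \<noteq> 0 then Y g else W g)" by metis
  have "Z e \<noteq> 0" "\<forall>g\<in>insert f A. Z g = 0" using Y W Z by auto
  with e(1) Z(1) show False by (auto simp: cov_span_def)
qed

text \<open>Steinitz replacement: an element of \<open>I\<close> missing from \<open>B\<close> is
  swapped for an element of \<open>B - I\<close>, which keeps the size and the span of
  \<open>I\<close> but brings \<open>B\<close> closer to \<open>I\<close>.\<close>

lemma cov_indep_card_le:
  assumes "finite B" "cov_indep L I" "I \<subseteq> cov_span L B"
  shows "finite I \<and> card I \<le> card B"
  using assms
proof (induction "card (B - I)" arbitrary: B rule: less_induct)
  case less
  show ?case
  proof (cases "I \<subseteq> B")
    case True
    then show ?thesis using less.prems by (auto intro: card_mono finite_subset)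
  next
    case False
    then obtain e where e: "e \<in> I" "e \<notin> B" by blast
    \<comment> \<open>The element to be discarded is any \<open>f\<close> of \<open>B\<close>
      outside a maximal \<open>C\<close> between \<open>B \<inter> I\<close> and \<open>B\<close>
      that still fails to span \<open>e\<close>; by maximality adding \<open>f\<close> spans
      \<open>e\<close>, so exchange applies.\<close>
    define \<C> where "\<C> = {C. B \<inter> I \<subseteq> C \<and> C \<subseteq> B \<and> e \<notin> cov_span L C}"
    have "e \<notin> cov_span L (B \<inter> I)"
      using less.prems(2) e cov_span_mono[of "B \<inter> I" "I - {e}" L]
      unfolding cov_indep_def by blast
    then have "\<C> \<noteq> {}" unfolding \<C>_def by auto
    moreover have "finite \<C>"
      unfolding \<C>_def by (rule finite_subset[of _ "Pow B"]) (use less.prems in auto)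
    ultimately have "\<exists>C\<in>\<C>. \<forall>D\<in>\<C>. C \<subseteq> D \<longrightarrow> C = D" by (intro finite_has_maximal)
    then obtain C where C: "C \<in> \<C>" "\<forall>D\<in>\<C>. C \<subseteq> D \<longrightarrow> C = D" by (rule bexE)
    have "C \<noteq> B" using C(1) e less.prems(3) by (auto simp: \<C>_def)
    then obtain f where f: "f \<in> B" "f \<notin> C" using C(1) by (auto simp: \<C>_def)
    have "f \<notin> I" using f C(1) by (auto simp: \<C>_def)
    have "insert f C \<notin> \<C>" using C(2) f by blast
    then have "e \<in> cov_span L (insert f C)" using C(1) f by (auto simp: \<C>_def)
    then have "f \<in> cov_span L (insert e C)"
      using cov_span_exchange C(1) by (auto simp: \<C>_def)
    then have f': "f \<in> cov_span L (insert e (B - {f}))"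
      using cov_span_mono[of "insert e C" "insert e (B - {f})" L] C(1) f by (auto simp: \<C>_def)
    define B' where "B' = insert e (B - {f})"
    have "B \<subseteq> cov_span L B'"
      using f' subset_cov_span[of B' L] unfolding B'_def by auto
    then have I: "I \<subseteq> cov_span L B'" using cov_span_trans less.prems(3) by blast
    have "card (B' - I) < card (B - I)"
      by (rule psubset_card_mono)
        (use less.prems e f \<open>f \<notin> I\<close> in \<open>auto simp: B'_def\<close>)
    moreover have "finite B'" using less.prems by (simp add: B'_def)
    moreover have "card B' = card B"
    proof -
      have "card B' = Suc (card (B - {f}))" using less.prems(1) e by (simp add: B'_def)
      also have "\<dots> = card B" using less.prems(1) f(1) by (rule card_Suc_Diff1)
      finally show ?thesis .
    qed
    ultimately show ?thesis using less.hyps[of B'] less.prems(2) I by simp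
  qed
qed

lemma cov_indep_subset_ground: "cov_indep L B \<Longrightarrow> B \<subseteq> E"
  unfolding cov_indep_def cov_span_def using covector_outside by blast

text \<open>
  On a minimal dependent set \<open>B\<close>, the covectors supported on pairs \<open>{c, f}\<close> through a fixed
  \<open>c\<close> prescribe the signs of a vector with support \<open>B\<close>.
\<close>

lemma dependent_imp_vector:
  assumes BE: "B \<subseteq> E" and dep: "\<not> cov_indep L B"
  shows "\<exists>X\<in>om_vectors E L. sv_support E X \<noteq> {} \<and> sv_support E X \<subseteq> B"
proof -
  let ?D = "{D. D \<subseteq> B \<and> \<not> cov_indep L D}"
  have "finite ?D"
    using BE finite_ground by (auto intro: finite_subset[of _ "Pow B"] finite_subset[of B])
  moreover have "?D \<noteq> {}" using dep by auto
  ultimately have "\<exists>D\<in>?D. \<forall>C\<in>?D. C \<subseteq> D \<longrightarrow> D = C" by (intro finite_has_minimal)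
  then obtain D where "D \<in> ?D" and min: "\<forall>C\<in>?D. C \<subseteq> D \<longrightarrow> D = C" by (rule bexE)
  then have D: "D \<subseteq> B" "\<not> cov_indep L D" by auto
  have ind: "cov_indep L (D - {f})" if "f \<in> D" for f
    using bspec[OF min, of "D - {f}"] D that by blast
  obtain c where c: "c \<in> D" "c \<in> cov_span L (D - {c})" using D by (auto simp: cov_indep_def)
  have finD: "finite D" using D BE finite_ground by (meson finite_subset)
  \<comment> \<open>\<open>D - {f}\<close> is independent by minimality, so a covector can be
    nonzero at \<open>c\<close> and vanish on the rest of it.\<close>
  have "\<exists>Y\<in>L. Y c = 1 \<and> (\<forall>g\<in>D - {c, f}. Y g = 0)" if f: "f \<in> D - {c}" for f
  proof -
    have "c \<notin> cov_span L (D - {f} - {c})" using ind[of f] f c by (auto simp: cov_indep_def)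
    then show ?thesis by (rule not_in_cov_spanE[where s = 1]) auto
  qed
  then obtain W where W: "\<And>f. f \<in> D - {c} \<Longrightarrow> W f \<in> L"
    "\<And>f. f \<in> D - {c} \<Longrightarrow> W f c = 1"
    "\<And>f g. f \<in> D - {c} \<Longrightarrow> g \<in> D - {c, f} \<Longrightarrow> W f g = 0" by metis
  have Wnz: "W f f \<noteq> 0" if f: "f \<in> D - {c}" for f
  proof
    assume "W f f = 0"
    then have "\<forall>g\<in>D - {c}. W f g = 0" using W(3)[OF f] by blast
    then have "W f c = 0" using c(2) W(1)[OF f] by (auto simp: cov_span_def)
    then show False using W(2)[OF f] by simp
  qed
  \<comment> \<open>The signs are forced by orthogonality to each \<open>W f\<close>: the products
    at \<open>c\<close> and at \<open>f\<close> must be \<open>1\<close> and \<open>-1\<close>, and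
    all others on \<open>D\<close> vanish.\<close>
  define X where "X = (\<lambda>f. if f = c then 1 else if f \<in> D then - W f f else 0)"
  \<comment> \<open>A covector weakly agreeing with \<open>X\<close> on \<open>D\<close> loses its
    entry at \<open>f\<close> when eliminated against \<open>W f\<close>, while its entry at
    \<open>c\<close> becomes positive. In the end only \<open>c\<close> is left, against
    \<open>c \<in> cov_span L (D - {c})\<close>.\<close>
  have no: False if "Y \<in> L" "\<And>f. f \<in> D \<Longrightarrow> X f * Y f \<ge> 0" "\<exists>f\<in>D. Y f \<noteq> 0" for Y
    using that
  proof (induction "card {f\<in>D - {c}. Y f \<noteq> 0}" arbitrary: Y rule: less_induct)
    case less
    show False
    proof (cases "\<exists>f\<in>D - {c}. Y f \<noteq> 0")
      case False
      then show False using c less.prems by (auto simp: cov_span_def)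
    next
      case True
      then obtain f where f: "f \<in> D - {c}" "Y f \<noteq> 0" by blast
      note Wnz[OF f(1)]
      moreover have "W f f * Y f \<le> 0" using less.prems(2)[of f] f by (auto simp: X_def)
      ultimately have "Y f * W f f < 0" using f(2) by (simp add: mult.commute order_less_le)
      then obtain Z where Z: "Z \<in> L" "Z f = 0"
        "\<And>g. Y g * W f g \<ge> 0 \<Longrightarrow> Z g = (if Y g \<noteq> 0 then Y g else W f g)"
        using covector_eliminate less.prems(1) W(1)[OF f(1)] by metis
      have "Y c \<ge> 0" using less.prems(2)[OF c(1)] by (simp add: X_def)
      then have Zc: "Z c > 0" using Z(3)[of c] W(2)[OF f(1)] by auto
      have Zg: "Z g = Y g" if "g \<in> D - {c, f}" for g
        using Z(3)[of g] W(3)[OF f(1) that] by auto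
      show False
      proof (rule less.hyps[OF _ Z(1)])
        show "card {g\<in>D - {c}. Z g \<noteq> 0} < card {g\<in>D - {c}. Y g \<noteq> 0}"
        proof (rule psubset_card_mono)
          have "Y g \<noteq> 0" if "g \<in> D - {c}" "Z g \<noteq> 0" for g
            using that f Z(2) Zg[of g] by (cases "g = f") auto
          then show "{g\<in>D - {c}. Z g \<noteq> 0} \<subset> {g\<in>D - {c}. Y g \<noteq> 0}" using f Z(2) by blast
        qed (use finD in simp)
        show "X g * Z g \<ge> 0" if "g \<in> D" for g
          using that Zc Zg[of g] Z(2) less.prems(2)[of g]
          by (cases "g = c"; cases "g = f") (auto simp: X_def)
        show "\<exists>g\<in>D. Z g \<noteq> 0" using Zc c(1) by force
      qed
    qed
  qed
  have Xnz: "X f \<noteq> 0" if "f \<in> D" for f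
  proof (cases "f = c")
    case False
    then have "f \<in> D - {c}" using that by blast
    then have "W f f \<noteq> 0" by (rule Wnz)
    then show ?thesis using False that by (simp add: X_def)
  qed (simp add: X_def)
  have X0: "X f = 0" if "f \<notin> D" for f
    using that c by (auto simp: X_def)
  have pos: "\<exists>e\<in>E. X e * Y e < 0" if Y: "Y \<in> L" "e \<in> E" "X e * Y e \<noteq> 0" for Y e
  proof (rule ccontr)
    assume "\<not> ?thesis"
    then have "X f * Y f \<ge> 0" if "f \<in> D" for f using D BE that by force
    moreover have "e \<in> D" using Y(3) X0[of e] by auto
    ultimately show False using no[OF Y(1)] Y(3) by auto
  qed
  have "sv_orthogonal E X Y" if Y: "Y \<in> L" for Y
  proof (cases "\<forall>e\<in>E. X e * Y e = 0")
    case False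
    then obtain e where e: "e \<in> E" "X e * Y e \<noteq> 0" by blast
    \<comment> \<open>\<open>Y\<close> supplies the negative product and its negation supplies the
      positive one.\<close>
    from pos[OF Y e] pos[OF covector_uminus[OF Y] e(1)] e(2)
    show ?thesis by (auto simp: sv_orthogonal_def)
  qed (simp add: sv_orthogonal_def)
  moreover have "sign_vector E X"
    unfolding sign_vector_def
  proof (intro conjI ballI allI impI)
    show "X e \<in> {-1, 0, 1}" if "e \<in> E" for e
      using covector_values[OF W(1), of e e] by (auto simp: X_def)
    show "X e = 0" if "e \<notin> E" for e using X0[of e] that D BE by auto
  qed
  ultimately have "X \<in> om_vectors E L" by (simp add: om_vectors_def)
  moreover have "sv_support E X = D" using Xnz X0 D BE by (auto simp: sv_support_def)
  ultimately show ?thesis using c D by blast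
qed

lemma vector_imp_circuit:
  assumes "X \<in> om_vectors E L" "sv_support E X \<noteq> {}"
  shows "\<exists>C\<in>om_circuits E L. sv_support E C \<subseteq> sv_support E X"
proof -
  let ?S = "sv_support E ` {Y \<in> om_vectors E L. sv_support E Y \<noteq> {} \<and>
    sv_support E Y \<subseteq> sv_support E X}"
  have "finite ?S"
    by (rule finite_subset[of _ "Pow E"]) (use finite_ground in \<open>auto simp: sv_support_def\<close>)
  moreover have "?S \<noteq> {}" using assms by auto
  ultimately have "\<exists>S\<in>?S. \<forall>T\<in>?S. T \<subseteq> S \<longrightarrow> S = T" by (intro finite_has_minimal)
  then obtain S where S: "S \<in> ?S" "\<forall>T\<in>?S. T \<subseteq> S \<longrightarrow> S = T" by (rule bexE)
  then obtain C where C: "S = sv_support E C" "C \<in> om_vectors E L" "sv_support E C \<noteq> {}"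
    "sv_support E C \<subseteq> sv_support E X" by blast
  have "\<not> sv_support E Y \<subset> sv_support E C" if "Y \<in> om_vectors E L" "sv_support E Y \<noteq> {}" for Y
    using bspec[OF S(2), of "sv_support E Y"] that C by blast
  then have "C \<in> om_circuits E L" using C by (auto simp: om_circuits_def)
  with C show ?thesis by blast
qed

text \<open>This ties the circuit definition of rank to covectors. A circuit inside a set
  independent in the covector sense would meet some covector in a single element, violating
  orthogonality; conversely a dependent set carries a vector, hence a circuit.\<close>

lemma om_indep_iff: "om_indep E L B \<longleftrightarrow> cov_indep L B"
proof
  assume "om_indep E L B"
  then have B: "B \<subseteq> E" "\<And>C. C \<in> om_circuits E L \<Longrightarrow> \<not> sv_support E C \<subseteq> B"
    by (auto simp: om_indep_def)
  show "cov_indep L B"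
  proof (rule ccontr)
    assume "\<not> cov_indep L B"
    then obtain X where X: "X \<in> om_vectors E L" "sv_support E X \<noteq> {}" "sv_support E X \<subseteq> B"
      using dependent_imp_vector[OF B(1)] by blast
    obtain C where "C \<in> om_circuits E L" "sv_support E C \<subseteq> sv_support E X"
      using vector_imp_circuit[OF X(1,2)] by blast
    with B(2)[of C] X(3) show False by blast
  qed
next
  assume B: "cov_indep L B"
  have False if C: "C \<in> om_circuits E L" "sv_support E C \<subseteq> B" for C
  proof -
    obtain e where e: "e \<in> sv_support E C" using C(1) by (auto simp: om_circuits_def)
    then have "e \<notin> cov_span L (B - {e})" using B C(2) by (auto simp: cov_indep_def)
    then obtain Y where Y: "Y \<in> L" "\<forall>f\<in>B - {e}. Y f = 0" "Y e \<noteq> 0"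
      by (auto simp: cov_span_def)
    have z: "C f * Y f = 0" if "f \<in> E" "f \<noteq> e" for f
      using that Y(2) C(2) by (auto simp: sv_support_def)
    have "sv_orthogonal E C Y" using C(1) Y(1) by (auto simp: om_circuits_def om_vectors_def)
    moreover have "e \<in> E" "C e * Y e \<noteq> 0" using e Y(3) by (auto simp: sv_support_def)
    ultimately obtain f g where "f \<in> E" "C f * Y f > 0" "g \<in> E" "C g * Y g < 0"
      unfolding sv_orthogonal_def by blast
    with z[of f] z[of g] show False by (cases "f = e"; cases "g = e") auto
  qed
  then show "om_indep E L B"
    using cov_indep_subset_ground[OF B] by (auto simp: om_indep_def)
qed

text \<open>Any basis of \<open>A\<close> computes the rank, as Steinitz replacement bounds every
  independent subset of \<open>A\<close> by it.\<close>

lemma om_rank_eqI: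
  assumes "cov_indep L B" "B \<subseteq> A" "A \<subseteq> cov_span L B"
  shows "om_rank E L A = card B"
proof -
  have fin: "finite B" using cov_indep_subset_ground[OF assms(1)] finite_ground finite_subset by blast
  have *: "card C \<le> card B" if "C \<subseteq> A" "om_indep E L C" for C
    using cov_indep_card_le[OF fin, of C] that assms(3) by (auto simp: om_indep_iff)
  have "finite (card ` {C. C \<subseteq> A \<and> om_indep E L C})"
    by (rule finite_subset[of _ "{..card B}"]) (use * in auto)
  then show ?thesis unfolding om_rank_def
    by (rule Max_eqI) (use * assms in \<open>auto simp: om_indep_iff\<close>)
qed

lemma cov_basis_exists:
  assumes "finite A"
  obtains B where "B \<subseteq> A" "cov_indep L B" "cov_span L B = cov_span L A"
proof -
  let ?S = "{B. B \<subseteq> A \<and> cov_span L B = cov_span L A}"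
  have "finite ?S" by (rule finite_subset[of _ "Pow A"]) (use assms in auto)
  moreover have "?S \<noteq> {}" by auto
  ultimately have "\<exists>B\<in>?S. \<forall>C\<in>?S. C \<subseteq> B \<longrightarrow> B = C" by (intro finite_has_minimal)
  then obtain B where B: "B \<in> ?S" and min: "\<forall>C\<in>?S. C \<subseteq> B \<longrightarrow> B = C" by (rule bexE)
  have "cov_indep L B" unfolding cov_indep_def
  proof (intro ballI notI)
    fix e assume e: "e \<in> B" "e \<in> cov_span L (B - {e})"
    then have "B \<subseteq> cov_span L (B - {e})" using subset_cov_span[of "B - {e}" L] by auto
    then have "cov_span L (B - {e}) = cov_span L B"
      using cov_span_trans cov_span_mono[of "B - {e}" B L] by blast
    then have "B - {e} = B" using bspec[OF min, of "B - {e}"] B by auto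
    with e show False by blast
  qed
  with B that show ?thesis by blast
qed

lemma spanning_card_rank_imp_indep:
  assumes "finite A" "A \<subseteq> F" "F \<subseteq> cov_span L A" "om_rank E L F = card A"
  shows "cov_indep L A"
proof -
  obtain B where B: "B \<subseteq> A" "cov_indep L B" "cov_span L B = cov_span L A"
    using cov_basis_exists[OF assms(1)] .
  have "om_rank E L F = card B" by (rule om_rank_eqI) (use B assms in auto)
  then show ?thesis using B assms(4) card_subset_eq[OF assms(1) B(1)] by auto
qed

text \<open>Composing covectors that each single out one element of \<open>B\<close> builds the
  pattern one entry at a time, since composition never overwrites a nonzero entry.\<close>

lemma cov_indep_pattern:
  assumes "finite T" "cov_indep L B" "T \<subseteq> B"
  obtains Y where "Y \<in> L" "\<And>e. e \<in> T \<Longrightarrow> Y e = 1" "\<And>e. e \<in> B - T \<Longrightarrow> Y e = 0"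
proof -
  from assms(1,3) have "\<exists>Y\<in>L. (\<forall>e\<in>T. Y e = 1) \<and> (\<forall>e\<in>B - T. Y e = 0)"
  proof induction
    case empty
    then show ?case using covector_zero by auto
  next
    case (insert e T)
    then obtain Y where Y: "Y \<in> L" "\<forall>e\<in>T. Y e = 1" "\<forall>e\<in>B - T. Y e = 0" by auto
    have "e \<notin> cov_span L (B - {e})" using assms(2) insert.prems by (auto simp: cov_indep_def)
    then obtain W where W: "W \<in> L" "\<And>f. f \<in> B - {e} \<Longrightarrow> W f = 0" "W e = 1"
      by (rule not_in_cov_spanE[where s = 1]) auto
    show ?case
      by (rule bexI[OF _ covector_comp[OF Y(1) W(1)]])
        (use Y W insert in \<open>auto simp: sv_comp_def\<close>)
  qed
  with that show ?thesis by blast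
qed

lemma om_faceI:
  assumes "Y \<in> L" "\<And>e. e \<in> E \<Longrightarrow> Y e \<ge> 0"
  shows "om_face E L (sv_zeros E Y)"
  using assms unfolding om_face_def sv_nonneg_def sv_zeros_def by blast

text \<open>Faces are flats. The intersection with \<open>E\<close> removes the elements outside the
  ground set, which every span contains.\<close>

lemma om_face_cov_span:
  assumes "om_face E L F"
  shows "F = E \<inter> cov_span L F"
proof -
  obtain Y where "Y \<in> L" "F = sv_zeros E Y" using assms by (auto simp: om_face_def)
  then have "E \<inter> cov_span L F \<subseteq> F" by (auto simp: sv_zeros_def cov_span_def)
  moreover have "F \<subseteq> E" using assms by (simp add: om_face_def)
  ultimately show ?thesis using subset_cov_span[of F L] by blast
qed

end


section \<open>Faces at a vertex\<close>

text \<open>No rank condition appears because two distinct elements always have rank 2, as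
  \<open>mp_edges_iff\<close> confirms.\<close>

definition neighbours :: "'a set \<Rightarrow> ('a \<Rightarrow> int) set \<Rightarrow> 'a \<Rightarrow> 'a set" where
  "neighbours E L v = {u \<in> E. u \<noteq> v \<and> om_face E L {v, u}}"

section \<open>From signs at the neighbours of a vertex to signs everywhere\<close>

context matroid_polytope
begin

lemma singleton_covector:
  assumes "v \<in> E"
  obtains P where "P \<in> L" "P v = 0" "\<And>e. e \<in> E \<Longrightarrow> e \<noteq> v \<Longrightarrow> P e = 1"
proof -
  obtain P where P: "P \<in> L" "sv_nonneg E P" "sv_zeros E P = {v}"
    using singleton_face[OF assms] by (auto simp: om_face_def)
  have "P e = 1" if "e \<in> E" "e \<noteq> v" for e
    using P that covector_values[OF P(1), of e] by (auto simp: sv_zeros_def sv_nonneg_def)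
  moreover have "P v = 0" using P by (auto simp: sv_zeros_def)
  ultimately show ?thesis using that P(1) by blast
qed

text \<open>No three points of a matroid polytope are collinear. Eliminating \<open>v\<close>
  between the vertex covector of \<open>a\<close> and the negated one of \<open>b\<close>, and then
  \<open>a\<close> against the vertex covector of \<open>v\<close>, isolates \<open>b\<close>. The
  sign is chosen to suit \<open>negative_face\<close>.\<close>

lemma triple_independent:
  assumes "v \<in> E" "a \<in> E" "b \<in> E" "v \<noteq> a" "v \<noteq> b" "a \<noteq> b"
  obtains W where "W \<in> L" "W v = 0" "W a = 0" "W b = -1"
proof -
  obtain V where V: "V \<in> L" "V v = 0" "\<And>e. e \<in> E \<Longrightarrow> e \<noteq> v \<Longrightarrow> V e = 1"
    using singleton_covector[OF assms(1)] by blast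
  obtain A where A: "A \<in> L" "A a = 0" "\<And>e. e \<in> E \<Longrightarrow> e \<noteq> a \<Longrightarrow> A e = 1"
    using singleton_covector[OF assms(2)] by blast
  obtain B where B: "B \<in> L" "B b = 0" "\<And>e. e \<in> E \<Longrightarrow> e \<noteq> b \<Longrightarrow> B e = 1"
    using singleton_covector[OF assms(3)] by blast
  obtain X where X: "X \<in> L" "X v = 0" "X a = -1" "X b = 1"
    using covector_eliminate[OF A(1) covector_uminus[OF B(1)], of v] A B assms
    by (smt (verit) mult_cancel_left1 mult_minus_right)
  obtain Z where Z: "Z \<in> L" "Z v = 0" "Z a = 0" "Z b = 1"
    using covector_eliminate[OF X(1) V(1), of a] X V assms
    by (smt (verit) mult_cancel_left1 mult_minus_right)
  show ?thesis using that[OF covector_uminus[OF Z(1)]] Z by auto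
qed

text \<open>Geometrically, the hyperplane of \<open>Y\<close> is rotated about \<open>v\<close>
  towards a hyperplane supporting only \<open>v\<close>, until no point is left on its negative
  side. The points then lying on it form a face, and apart from \<open>v\<close> they all started on
  the negative side.\<close>

lemma negative_face:
  assumes v: "v \<in> E" and Y: "Y \<in> L" "Y v = 0" "Y e < 0"
  obtains F where "om_face E L F" "v \<in> F" "F \<noteq> {v}" "\<And>f. f \<in> F - {v} \<Longrightarrow> Y f < 0"
proof -
  obtain P where P: "P \<in> L" "P v = 0" "\<And>e. e \<in> E \<Longrightarrow> e \<noteq> v \<Longrightarrow> P e = 1"
    using singleton_covector[OF v] by blast
  \<comment> \<open>Each elimination against \<open>P\<close> turns one negative entry into zero and
    makes every nonnegative entry away from \<open>v\<close> positive, so nonpositive entries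
    survive only where \<open>Y\<close> is negative.\<close>
  have step: "\<exists>F. om_face E L F \<and> v \<in> F \<and> F \<noteq> {v} \<and> (\<forall>f\<in>F - {v}. Y f < 0)"
    if "Z \<in> L" "Z v = 0" "\<exists>e\<in>E - {v}. Z e \<le> 0" "\<And>e. e \<in> E - {v} \<Longrightarrow> Z e \<le> 0 \<Longrightarrow> Y e < 0" for Z
    using that
  proof (induction "card {f\<in>E. Z f < 0}" arbitrary: Z rule: less_induct)
    case less
    show ?case
    proof (cases "\<exists>f\<in>E. Z f < 0")
      case False
      then have "om_face E L (sv_zeros E Z)"
        using om_faceI[OF less.prems(1)] by (meson not_le)
      moreover have "v \<in> sv_zeros E Z" "sv_zeros E Z \<noteq> {v}" "\<forall>f\<in>sv_zeros E Z - {v}. Y f < 0"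
        using False less.prems v by (force simp: sv_zeros_def)+
      ultimately show ?thesis by blast
    next
      case True
      then obtain f where f: "f \<in> E" "Z f < 0" by blast
      then have "f \<noteq> v" using less.prems(2) by auto
      then have "P f * Z f < 0" using P f by simp
      then obtain X where X: "X \<in> L" "X f = 0"
        "\<And>g. P g * Z g \<ge> 0 \<Longrightarrow> X g = (if P g \<noteq> 0 then P g else Z g)"
        using covector_eliminate[OF P(1) less.prems(1)] by metis
      have Xg: "X g = 1" if "g \<in> E - {v}" "Z g \<ge> 0" for g
        using that P X(3)[of g] by auto
      have Xv: "X v = 0" using X(3)[of v] P less.prems(2) by auto
      show ?thesis
      proof (rule less.hyps[OF _ X(1) Xv])
        have "{g\<in>E. X g < 0} \<subseteq> {g\<in>E. Z g < 0}"
        proof clarify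
          fix g assume g: "g \<in> E" "X g < 0"
          then have "g \<noteq> v" using Xv by auto
          then show "Z g < 0" using Xg[of g] g by force
        qed
        then show "card {g\<in>E. X g < 0} < card {g\<in>E. Z g < 0}"
          using finite_ground f X(2) by (intro psubset_card_mono psubsetI) force+
        show "\<exists>g\<in>E - {v}. X g \<le> 0" using f \<open>f \<noteq> v\<close> X(2) by (intro bexI[of _ f]) auto
        show "Y g < 0" if g: "g \<in> E - {v}" "X g \<le> 0" for g
          using Xg[of g] g less.prems(4)[of g] by force
      qed
    qed
  qed
  have e: "e \<in> E - {v}" using Y covector_outside[of Y e] by auto
  \<comment> \<open>Composing with \<open>P\<close> first makes the zeros of \<open>Y\<close> other
    than \<open>v\<close> positive, so they cannot enter the face.\<close>
  have "\<exists>F. om_face E L F \<and> v \<in> F \<and> F \<noteq> {v} \<and> (\<forall>f\<in>F - {v}. Y f < 0)"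
  proof (rule step[OF covector_comp[OF Y(1) P(1)]])
    show "sv_comp Y P v = 0" using Y P by (simp add: sv_comp_def)
    show "\<exists>f\<in>E - {v}. sv_comp Y P f \<le> 0"
      using e Y(3) by (intro bexI[of _ e]) (auto simp: sv_comp_def)
    show "Y f < 0" if "f \<in> E - {v}" "sv_comp Y P f \<le> 0" for f
      using that P(3)[of f] by (auto simp: sv_comp_def split: if_splits)
  qed
  with that show ?thesis by blast
qed

text \<open>If \<open>F\<close> has further points \<open>a\<close> and \<open>b\<close>, a covector
  zero at \<open>v\<close> and \<open>a\<close> and negative at \<open>b\<close>, composed after the
  covector of \<open>F\<close>, is negative only inside \<open>F - {a}\<close>. By
  \<open>negative_face\<close> there is then a strictly smaller face at \<open>v\<close>.\<close>

lemma face_contains_neighbour: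
  assumes "om_face E L F" "v \<in> F" "F \<noteq> {v}"
  shows "\<exists>u\<in>F. u \<in> neighbours E L v"
  using assms
proof (induction "card F" arbitrary: F rule: less_induct)
  case less
  have FE: "F \<subseteq> E" "finite F" using less.prems(1) finite_ground
    by (auto simp: om_face_def intro: finite_subset)
  obtain a where a: "a \<in> F" "a \<noteq> v" using less.prems by blast
  show ?case
  proof (cases "F = {v, a}")
    case True
    then show ?thesis using less.prems a FE by (auto simp: neighbours_def)
  next
    case False
    then obtain b where b: "b \<in> F" "b \<noteq> v" "b \<noteq> a" using less.prems a by blast
    obtain W where W: "W \<in> L" "W v = 0" "W a = 0" "W b = -1"
      by (rule triple_independent[of v a b]) (use a b less.prems FE in auto)
    obtain Y where Y: "Y \<in> L" "sv_nonneg E Y" "sv_zeros E Y = F"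
      using less.prems(1) by (auto simp: om_face_def)
    have Y0: "Y f = 0" if "f \<in> F" for f using that Y(3) by (auto simp: sv_zeros_def)
    obtain F' where F': "om_face E L F'" "v \<in> F'" "F' \<noteq> {v}"
      "\<And>f. f \<in> F' - {v} \<Longrightarrow> sv_comp Y W f < 0"
      by (rule negative_face[of v "sv_comp Y W" b])
        (use covector_comp[OF Y(1) W(1)] W Y0 less.prems(2) b FE in \<open>auto simp: sv_comp_def\<close>)
    have "F' \<subseteq> F - {a}"
    proof
      fix f assume f: "f \<in> F'"
      then have fE: "f \<in> E" using F'(1) by (auto simp: om_face_def)
      show "f \<in> F - {a}"
      proof (cases "f = v")
        case False
        then have "sv_comp Y W f < 0" using F'(4) f by blast
        then have "Y f = 0" "W f < 0" using Y(2) fE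
          by (auto simp: sv_comp_def sv_nonneg_def split: if_splits)
        then show ?thesis using fE Y(3) W(3) by (auto simp: sv_zeros_def)
      qed (use less.prems a in auto)
    qed
    then have "F' \<subset> F" using a by blast
    then show ?thesis using less.hyps[OF _ F'(1-3)] FE psubset_card_mono by blast
  qed
qed

text \<open>The analogue of the fact behind the simplex method that a local optimum is global: a
  negative entry gives a face at \<open>v\<close> that is negative off \<open>v\<close>, and this
  face contains a neighbour.\<close>

lemma nonneg_if_nonneg_on_neighbours:
  assumes "v \<in> E" "Y \<in> L" "Y v = 0" "\<And>u. u \<in> neighbours E L v \<Longrightarrow> Y u \<ge> 0"
  shows "Y e \<ge> 0"
proof (rule ccontr)
  assume "\<not> Y e \<ge> 0"
  then obtain F where F: "om_face E L F" "v \<in> F" "F \<noteq> {v}" "\<And>f. f \<in> F - {v} \<Longrightarrow> Y f < 0"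
    using negative_face[OF assms(1-3), of e] by (metis not_le)
  obtain u where "u \<in> F" "u \<in> neighbours E L v" using face_contains_neighbour[OF F(1-3)] by blast
  then show False using F(4)[of u] assms(4)[of u] by (auto simp: neighbours_def)
qed

text \<open>Otherwise some \<open>W\<close> vanishes at \<open>v\<close> and its neighbours in
  \<open>F\<close> but is negative at a point of \<open>F\<close>. Composed after the covector of
  \<open>F\<close>, which is positive on the other neighbours, it contradicts the local-to-global
  principle.\<close>

lemma face_spanned_by_neighbours:
  assumes F: "om_face E L F" and v: "v \<in> F"
  shows "F \<subseteq> cov_span L (insert v (neighbours E L v \<inter> F))"
proof (rule subsetI, rule ccontr)
  fix e assume e: "e \<in> F" "e \<notin> cov_span L (insert v (neighbours E L v \<inter> F))"
  obtain W where W: "W \<in> L" "\<And>f. f \<in> insert v (neighbours E L v \<inter> F) \<Longrightarrow> W f = 0" "W e = -1"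
    using not_in_cov_spanE[OF e(2), of "-1"] by auto
  obtain Y where Y: "Y \<in> L" "sv_nonneg E Y" "sv_zeros E Y = F"
    using F by (auto simp: om_face_def)
  have Y0: "Y f = 0" if "f \<in> F" for f using that Y(3) by (auto simp: sv_zeros_def)
  have "sv_comp Y W u \<ge> 0" if u: "u \<in> neighbours E L v" for u
  proof (cases "u \<in> F")
    case True
    then show ?thesis using u Y0 W by (auto simp: sv_comp_def)
  next
    case False
    then show ?thesis using u Y(2,3)
      by (auto simp: sv_comp_def neighbours_def sv_nonneg_def sv_zeros_def)
  qed
  moreover have "sv_comp Y W v = 0" using Y0 v W by (auto simp: sv_comp_def)
  moreover have "v \<in> E" using F v by (auto simp: om_face_def)
  ultimately have "sv_comp Y W e \<ge> 0"
    using nonneg_if_nonneg_on_neighbours covector_comp[OF Y(1) W(1)] by blast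
  then show False using Y0[OF e(1)] W(3) by (simp add: sv_comp_def)
qed

text \<open>The case \<open>u = v\<close> says that there are no loops.\<close>

lemma cov_indep_pair:
  assumes "u \<in> E" "v \<in> E"
  shows "cov_indep L {u, v}"
proof (cases "u = v")
  case True
  have "\<exists>P\<in>L. P v \<noteq> 0"
  proof (rule ccontr)
    assume "\<not> ?thesis"
    then have z: "Y v = 0" if "Y \<in> L" for Y using that by blast
    have "w = v" if w: "w \<in> E" for w
    proof (rule ccontr)
      assume "w \<noteq> v"
      obtain P where "P \<in> L" "P v = 1"
        using singleton_covector[OF w] assms(2) \<open>w \<noteq> v\<close> by blast
      with z[of P] show False by simp
    qed
    then have E: "E = {v}" using assms(2) by blast
    \<comment> \<open>With a second point, its vertex covector is nonzero at \<open>v\<close>. On a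
      one-point ground set a loop would be a positive circuit, so acyclicity is what excludes
      it.\<close>
    let ?C = "\<lambda>e. if e = v then 1 else 0 :: int"
    have "?C \<in> om_vectors E L"
      by (auto simp: om_vectors_def sign_vector_def sv_orthogonal_def E z)
    then have "?C \<in> om_circuits E L"
      by (auto simp: om_circuits_def sv_support_def E)
    moreover have "sv_nonneg E ?C" by (simp add: sv_nonneg_def)
    ultimately show False using acyclic unfolding om_acyclic_def by blast
  qed
  then have "v \<notin> cov_span L {}" by (auto simp: cov_span_def)
  then show ?thesis using True by (simp add: cov_indep_def)
next
  case False
  obtain P where P: "P \<in> L" "P v = 0" "P u = 1"
    using singleton_covector[OF assms(2)] assms(1) False by metis
  obtain Q where Q: "Q \<in> L" "Q u = 0" "Q v = 1"
    using singleton_covector[OF assms(1)] assms(2) False by metis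
  have "u \<notin> cov_span L {v}" using P by (auto simp: cov_span_def intro!: bexI[of _ P])
  moreover have "v \<notin> cov_span L {u}" using Q by (auto simp: cov_span_def intro!: bexI[of _ Q])
  moreover have "{u, v} - {u} = {v}" "{u, v} - {v} = {u}" using False by auto
  ultimately show ?thesis by (simp add: cov_indep_def)
qed

lemma mp_edges_iff:
  assumes "v \<in> E"
  shows "{v, u} \<in> mp_edges E L \<longleftrightarrow> u \<in> neighbours E L v"
proof
  assume "{v, u} \<in> mp_edges E L"
  then have face: "om_face E L {v, u}" and rk: "om_rank E L {v, u} = 2"
    by (auto simp: mp_edges_def)
  have "u \<noteq> v"
  proof
    assume "u = v"
    then have "om_rank E L {v, u} = card {v}"
      using cov_indep_pair[OF assms assms] by (intro om_rank_eqI) (auto intro: in_cov_span)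
    with rk show False by simp
  qed
  with face show "u \<in> neighbours E L v" by (auto simp: neighbours_def om_face_def)
next
  assume u: "u \<in> neighbours E L v"
  then have "om_rank E L {v, u} = card {v, u}"
    using cov_indep_pair[OF assms] by (intro om_rank_eqI) (auto simp: neighbours_def intro: in_cov_span)
  with u show "{v, u} \<in> mp_edges E L" by (auto simp: mp_edges_def neighbours_def)
qed

lemma card_edges_at:
  assumes "v \<in> E"
  shows "card {e \<in> mp_edges E L. v \<in> e} = card (neighbours E L v)"
proof -
  have "{e \<in> mp_edges E L. v \<in> e} = (\<lambda>u. {v, u}) ` neighbours E L v"
  proof (intro set_eqI iffI)
    fix e assume e: "e \<in> {e \<in> mp_edges E L. v \<in> e}"
    then obtain u where "e = {v, u}" by (auto simp: mp_edges_def insert_commute)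
    with e show "e \<in> (\<lambda>u. {v, u}) ` neighbours E L v" using mp_edges_iff[OF assms] by auto
  qed (use mp_edges_iff[OF assms] in auto)
  moreover have "inj_on (\<lambda>u. {v, u}) (neighbours E L v)"
    by (auto simp: inj_on_def neighbours_def doubleton_eq_iff)
  ultimately show ?thesis by (simp add: card_image)
qed

lemma finite_neighbours: "finite (neighbours E L v)"
  using finite_ground by (auto simp: neighbours_def)

lemma om_face_ground: "om_face E L E"
  using om_faceI[OF covector_zero] by (simp add: sv_zeros_def)

end

section \<open>Simplicity: a vertex and its neighbours form a basis\<close>

context simple_matroid_polytope
begin

lemma rank_pos:
  assumes "v \<in> E"
  shows "om_rank E L E \<ge> 1"
proof -
  obtain B where B: "B \<subseteq> E" "cov_indep L B" "cov_span L B = cov_span L E"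
    using cov_basis_exists[OF finite_ground] .
  have r: "om_rank E L E = card B" using B subset_cov_span[of E L] by (intro om_rank_eqI) auto
  have "{v} \<subseteq> cov_span L B" using B assms by (simp add: in_cov_span)
  moreover have "finite B" using B finite_ground finite_subset by blast
  ultimately show ?thesis
    using cov_indep_card_le[of B "{v}"] cov_indep_pair[OF assms assms] r by simp
qed

lemma card_neighbours: "v \<in> E \<Longrightarrow> card (neighbours E L v) = om_rank E L E - 1"
  using simple card_edges_at by simp

text \<open>The star spans \<open>E\<close>, as \<open>E\<close> is itself a face, and by simplicity
  it has \<open>1 + (r - 1) = r\<close> elements; a spanning set of that size is a basis.
  \<open>rank_pos\<close> keeps the subtraction from truncating.\<close>

lemma cov_indep_star:
  assumes v: "v \<in> E"
  shows "cov_indep L (insert v (neighbours E L v))"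
proof (rule spanning_card_rank_imp_indep[of _ E])
  have "v \<notin> neighbours E L v" by (simp add: neighbours_def)
  then show "om_rank E L E = card (insert v (neighbours E L v))"
    using finite_neighbours card_neighbours[OF v] rank_pos[OF v] by simp
  have "neighbours E L v \<inter> E = neighbours E L v" by (auto simp: neighbours_def)
  then show "E \<subseteq> cov_span L (insert v (neighbours E L v))"
    using face_spanned_by_neighbours[OF om_face_ground v] by simp
qed (use finite_neighbours v in \<open>auto simp: neighbours_def\<close>)

lemma face_rank:
  assumes F: "om_face E L F" and v: "v \<in> F"
  shows "om_rank E L F = Suc (card (neighbours E L v \<inter> F))"
proof -
  have vE: "v \<in> E" using F v by (auto simp: om_face_def)
  have "cov_indep L (insert v (neighbours E L v \<inter> F))"
    by (rule cov_indep_subset[OF cov_indep_star[OF vE]]) blast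
  then have "om_rank E L F = card (insert v (neighbours E L v \<inter> F))"
    by (rule om_rank_eqI) (use face_spanned_by_neighbours[OF F v] v in auto)
  also have "\<dots> = Suc (card (neighbours E L v \<inter> F))"
    using finite_neighbours by (subst card_insert_disjoint) (auto simp: neighbours_def)
  finally show ?thesis .
qed

text \<open>Combinatorially the vertex figure is a simplex. A face is recovered as the closure of
  \<open>v\<close> and its neighbours in it. Conversely, a covector that is zero on \<open>v\<close>
  and \<open>S\<close> and one on the remaining neighbours exists by independence and is nonnegative
  everywhere by the local-to-global principle.\<close>

lemma bij_betw_faces_neighbours:
  assumes v: "v \<in> E"
  shows "bij_betw (\<lambda>F. neighbours E L v \<inter> F) {F. om_face E L F \<and> v \<in> F} (Pow (neighbours E L v))"
proof (rule bij_betw_imageI)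
  show "inj_on (\<lambda>F. neighbours E L v \<inter> F) {F. om_face E L F \<and> v \<in> F}"
  proof (rule inj_onI, clarify)
    have eq: "F = E \<inter> cov_span L (insert v (neighbours E L v \<inter> F))"
      if F: "om_face E L F" "v \<in> F" for F
      using om_face_cov_span[OF F(1)] face_spanned_by_neighbours[OF F]
        cov_span_mono[of "insert v (neighbours E L v \<inter> F)" F L] F(2) by blast
    fix F G assume "om_face E L F" "v \<in> F" "om_face E L G" "v \<in> G"
      "neighbours E L v \<inter> F = neighbours E L v \<inter> G"
    then show "F = G" using eq[of F] eq[of G] by simp
  qed
  show "(\<lambda>F. neighbours E L v \<inter> F) ` {F. om_face E L F \<and> v \<in> F} = Pow (neighbours E L v)"
  proof (intro equalityI subsetI)
    fix S assume S: "S \<in> Pow (neighbours E L v)"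
    let ?T = "neighbours E L v - S"
    have v': "v \<notin> neighbours E L v" by (simp add: neighbours_def)
    obtain Y where Y: "Y \<in> L" "\<And>e. e \<in> ?T \<Longrightarrow> Y e = 1"
      "\<And>e. e \<in> insert v (neighbours E L v) - ?T \<Longrightarrow> Y e = 0"
      by (rule cov_indep_pattern[OF _ cov_indep_star[OF v], of ?T])
        (use finite_neighbours in auto)
    have Yu: "Y u \<ge> 0" if "u \<in> neighbours E L v" for u
      using Y(2,3)[of u] that by (cases "u \<in> S") auto
    have "Y e \<ge> 0" for e
      by (rule nonneg_if_nonneg_on_neighbours[OF v Y(1) _ Yu]) (use Y(3)[of v] v' in auto)
    then have "om_face E L (sv_zeros E Y)" using om_faceI[OF Y(1)] by blast
    moreover have "v \<in> sv_zeros E Y" using Y(3)[of v] v v' by (auto simp: sv_zeros_def)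
    moreover have "neighbours E L v \<inter> sv_zeros E Y = S"
    proof -
      have "u \<in> sv_zeros E Y \<longleftrightarrow> u \<in> S" if u: "u \<in> neighbours E L v" for u
        using Y(2,3)[of u] u by (cases "u \<in> S") (auto simp: sv_zeros_def neighbours_def)
      then show ?thesis using S by blast
    qed
    ultimately show "S \<in> (\<lambda>F. neighbours E L v \<inter> F) ` {F. om_face E L F \<and> v \<in> F}" by blast
  qed auto
qed


section \<open>Counting faces by their sinks\<close>

definition out_neighbours :: "'a rel \<Rightarrow> 'a \<Rightarrow> 'a set" where
  "out_neighbours R v = {u \<in> neighbours E L v. (u, v) \<in> R}"

lemma out_degree_restrict:
  assumes "F \<subseteq> E" "v \<in> F"
  shows "out_degree (mp_digraph E L R \<restriction> F) v = card (out_neighbours R v \<inter> F)"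
proof -
  have "out_arcs (mp_digraph E L R \<restriction> F) v = Pair v ` (out_neighbours R v \<inter> F)"
    using assms mp_edges_iff[of v]
    by (auto simp: out_arcs_def mp_digraph_def induce_subgraph_def out_neighbours_def)
  then show ?thesis unfolding out_degree_def by (simp add: card_image inj_on_def)
qed

lemma out_degree_eq:
  assumes "v \<in> E"
  shows "out_degree (mp_digraph E L R) v = card (out_neighbours R v)"
proof -
  have "out_arcs (mp_digraph E L R) v = Pair v ` out_neighbours R v"
    using assms mp_edges_iff[of v]
    by (auto simp: out_arcs_def mp_digraph_def out_neighbours_def)
  then show ?thesis unfolding out_degree_def by (simp add: card_image inj_on_def)
qed

text \<open>Being a sink depends on \<open>F\<close> only through its trace on the neighbours of
  \<open>v\<close>, which is the form the bijection with subsets needs.\<close>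

lemma is_sink_iff:
  assumes "F \<subseteq> E"
  shows "is_sink (mp_digraph E L R \<restriction> F) v \<longleftrightarrow>
    v \<in> F \<and> neighbours E L v \<inter> F \<subseteq> neighbours E L v - out_neighbours R v"
proof (cases "v \<in> F")
  case True
  have "finite (out_neighbours R v \<inter> F)"
    using finite_neighbours by (auto simp: out_neighbours_def)
  with True show ?thesis
    using out_degree_restrict[OF assms True, of R]
    by (auto simp: is_sink_def induce_subgraph_def mp_digraph_def out_neighbours_def)
qed (simp add: is_sink_def induce_subgraph_def)

text \<open>Under the bijection these faces become the \<open>k\<close>-subsets of the in-neighbours
  of \<open>v\<close>, of which there are \<open>r - 1\<close> minus the outdegree.\<close>

lemma card_faces_with_sink:
  assumes v: "v \<in> E"
  shows "card {F. om_face E L F \<and> om_rank E L F = Suc k \<and> is_sink (mp_digraph E L R \<restriction> F) v} =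
    (om_rank E L E - 1 - out_degree (mp_digraph E L R) v) choose k"
proof -
  let ?N = "neighbours E L v" and ?I = "neighbours E L v - out_neighbours R v"
  let ?A = "{F. om_face E L F \<and> om_rank E L F = Suc k \<and> is_sink (mp_digraph E L R \<restriction> F) v}"
  let ?B = "{S. S \<subseteq> ?I \<and> card S = k}"
  have A: "F \<in> ?A \<longleftrightarrow> om_face E L F \<and> v \<in> F \<and> ?N \<inter> F \<in> ?B" for F
  proof (cases "om_face E L F \<and> v \<in> F")
    case True
    then show ?thesis using face_rank[of F v] is_sink_iff[of F R v] by (auto simp: om_face_def)
  qed (auto simp: is_sink_def induce_subgraph_def)
  note bij = bij_betw_faces_neighbours[OF v]
  have "bij_betw (\<lambda>F. ?N \<inter> F) ?A ?B"
  proof (rule bij_betw_imageI)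
    show "inj_on (\<lambda>F. ?N \<inter> F) ?A"
      by (rule inj_on_subset[OF bij_betw_imp_inj_on[OF bij]]) (use A in blast)
    show "(\<lambda>F. ?N \<inter> F) ` ?A = ?B"
    proof (intro equalityI subsetI)
      fix S assume S: "S \<in> ?B"
      then have "S \<in> (\<lambda>F. ?N \<inter> F) ` {F. om_face E L F \<and> v \<in> F}"
        using bij_betw_imp_surj_on[OF bij] by blast
      with S show "S \<in> (\<lambda>F. ?N \<inter> F) ` ?A" using A by blast
    qed (use A in blast)
  qed
  then have "card ?A = card ?B" by (rule bij_betw_same_card)
  also have "\<dots> = card ?I choose k" using finite_neighbours by (simp add: n_subsets)
  also have "card ?I = card ?N - card (out_neighbours R v)"
    by (rule card_Diff_subset) (auto simp: out_neighbours_def finite_neighbours)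
  finally show ?thesis using card_neighbours[OF v] out_degree_eq[OF v] by simp
qed

text \<open>The K-ordering makes the faces of rank \<open>Suc k\<close> a disjoint union over their
  unique sinks.\<close>

lemma card_faces_by_sinks:
  assumes K: "K_ordering E L R"
  shows "card {F. om_face E L F \<and> om_rank E L F = Suc k} =
    (\<Sum>v\<in>E. (om_rank E L E - 1 - out_degree (mp_digraph E L R) v) choose k)"
proof -
  let ?A = "\<lambda>v. {F. om_face E L F \<and> om_rank E L F = Suc k \<and> is_sink (mp_digraph E L R \<restriction> F) v}"
  have sub: "?A v \<subseteq> Pow E" for v by (auto simp: om_face_def)
  have sink: "\<exists>!v. is_sink (mp_digraph E L R \<restriction> F) v"
    if F: "om_face E L F" "om_rank E L F = Suc k" for F
  proof -
    \<comment> \<open>A positive rank rules out the empty face, for which a K-ordering promises no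
      sink.\<close>
    have "om_rank E L {} = 0"
      using om_rank_eqI[of "{}" "{}"] by (simp add: cov_indep_def)
    then show ?thesis using F K by (auto simp: K_ordering_def)
  qed
  have "{F. om_face E L F \<and> om_rank E L F = Suc k} = (\<Union>v\<in>E. ?A v)"
  proof (intro equalityI subsetI)
    fix F assume "F \<in> {F. om_face E L F \<and> om_rank E L F = Suc k}"
    moreover from this obtain v where "is_sink (mp_digraph E L R \<restriction> F) v" using sink by blast
    ultimately show "F \<in> (\<Union>v\<in>E. ?A v)"
      by (auto simp: is_sink_def induce_subgraph_def om_face_def)
  qed auto
  also have "card \<dots> = (\<Sum>v\<in>E. card (?A v))"
  proof (rule card_UN_disjoint[OF finite_ground])
    show "\<forall>v\<in>E. finite (?A v)" using sub finite_ground by (meson finite_Pow_iff finite_subset)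
    show "\<forall>v\<in>E. \<forall>w\<in>E. v \<noteq> w \<longrightarrow> ?A v \<inter> ?A w = {}" using sink by blast
  qed
  finally show ?thesis using card_faces_with_sink by simp
qed

end

section \<open>Binomial inversion\<close>

text \<open>With \<open>d = r - 1\<close>, this is the contribution to \<open>h_star\<close> at
  \<open>l\<close> of one vertex of outdegree \<open>m\<close>. Terms with \<open>i < m\<close>
  vanish; on the others the product of binomials factors as a constant times an entry of row
  \<open>l - m\<close>, whose alternating sum is zero unless \<open>l = m\<close>.\<close>

lemma binomial_inversion_kernel:
  fixes d l m :: nat
  assumes "l \<le> d" "m \<le> d"
  shows "(\<Sum>i=0..l. (-1) ^ (l - i) * int ((d - i) choose (l - i)) * int ((d - m) choose (d - i))) =
    (if m = l then 1 else 0)"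
proof -
  let ?t = "\<lambda>i. (-1) ^ (l - i) * int ((d - i) choose (l - i)) * int ((d - m) choose (d - i))"
  have zero: "?t i = 0" if "i < m" for i
    using that assms by (simp add: binomial_eq_0)
  show ?thesis
  proof (cases "m \<le> l")
    case False
    then show ?thesis using zero by (auto intro!: sum.neutral)
  next
    case True
    have t: "?t i = int ((d - m) choose (d - l)) * ((-1) ^ (l - i) * int ((l - m) choose (l - i)))"
      if "i \<in> {m..l}" for i
    proof -
      have "(d - i) choose (l - i) = (d - i) choose (d - l)"
        using binomial_symmetric[of "l - i" "d - i"] that assms by auto
      moreover have "((d - m) choose (d - i)) * ((d - i) choose (d - l)) =
          ((d - m) choose (d - l)) * ((l - m) choose (l - i))"
        using choose_mult[of "d - l" "d - i" "d - m"] that assms by auto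
      ultimately show ?thesis by (simp add: algebra_simps flip: of_nat_mult)
    qed
    have "sum ?t {0..l} = sum ?t {m..l}"
      by (rule sum.mono_neutral_right) (use zero in \<open>auto simp del: mult_eq_0_iff\<close>)
    also have "\<dots> = int ((d - m) choose (d - l)) *
        (\<Sum>i=m..l. (-1) ^ (l - i) * int ((l - m) choose (l - i)))"
      unfolding sum_distrib_left by (rule sum.cong[OF refl t])
    also have "(\<Sum>i=m..l. (-1) ^ (l - i) * int ((l - m) choose (l - i))) =
        (\<Sum>j\<le>l - m. (-1) ^ j * int ((l - m) choose j))"
      by (rule sum.reindex_bij_witness[of _ "\<lambda>j. l - j" "\<lambda>i. l - i"]) (use True in auto)
    also have "int ((d - m) choose (d - l)) * \<dots> = (if m = l then 1 else 0)"
      using choose_alternating_sum[of "l - m", where 'a = int] True by (cases "m = l") auto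
    finally show ?thesis .
  qed
qed

context simple_matroid_polytope
begin

lemma d_plus_eq_h_star:
  assumes K: "K_ordering E L R" and l: "l < om_rank E L E"
  shows "int (d_plus E L R l) = h_star E L l"
proof -
  define d where "d = om_rank E L E - 1"
  let ?o = "\<lambda>v. out_degree (mp_digraph E L R) v"
  have o: "?o v \<le> d" if "v \<in> E" for v
    using card_mono[OF finite_neighbours, of "out_neighbours R v" v] that
    by (auto simp: d_def out_degree_eq card_neighbours out_neighbours_def)
  have ld: "l \<le> d" using l by (simp add: d_def)
  \<comment> \<open>The face number with index \<open>r - 1 - i\<close> counts faces of rank
    \<open>r - i\<close>, which is \<open>Suc (d - i)\<close> because
    \<open>i \<le> l < r\<close>.\<close>
  have f: "int (f_number E L (int (om_rank E L E) - 1 - int i)) =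
      (\<Sum>v\<in>E. int ((d - ?o v) choose (d - i)))" if "i \<le> l" for i
  proof -
    have "{F. om_face E L F \<and> int (om_rank E L F) = int (om_rank E L E) - 1 - int i + 1} =
        {F. om_face E L F \<and> om_rank E L F = Suc (d - i)}"
      using that l by (auto simp: d_def)
    then show ?thesis
      using card_faces_by_sinks[OF K, of "d - i"] by (simp add: f_number_def d_def)
  qed
  have "h_star E L l = (\<Sum>i=0..l. (-1) ^ (l - i) * int ((d - i) choose (l - i)) *
      (\<Sum>v\<in>E. int ((d - ?o v) choose (d - i))))"
    unfolding h_star_def Let_def d_def[symmetric] using f by (intro sum.cong) auto
  \<comment> \<open>After exchanging the sums, the kernel identity turns the inner sum into the
    indicator of outdegree \<open>l\<close>.\<close>
  also have "\<dots> = (\<Sum>v\<in>E. \<Sum>i=0..l. (-1) ^ (l - i) * int ((d - i) choose (l - i)) *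
      int ((d - ?o v) choose (d - i)))"
    unfolding sum_distrib_left by (rule sum.swap)
  also have "\<dots> = (\<Sum>v\<in>E. if ?o v = l then 1 else 0)"
    using binomial_inversion_kernel[OF ld o] by (intro sum.cong) auto
  also have "\<dots> = int (d_plus E L R l)"
    using finite_ground by (simp add: d_plus_def sum.If_cases Int_def)
  finally show ?thesis by simp
qed

end

theorem theorem2p5:
  fixes E :: "'a set" and L :: "('a \<Rightarrow> int) set" and R :: "'a rel" and r :: nat
  assumes "simple_matroid_polytope E L"
    and "om_rank E L E = r"
    and "K_ordering E L R"
  shows "(\<forall>l<r. int (d_plus E L R l) = h_star E L l) \<and>
         (\<forall>R'. K_ordering E L R' \<longrightarrow> (\<forall>l<r. d_plus E L R' l = d_plus E L R l))"
proof -
  interpret simple_matroid_polytope E L by fact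
  have "int (d_plus E L R' l) = h_star E L l" if "K_ordering E L R'" "l < r" for R' l
    using d_plus_eq_h_star that assms(2) by simp
  then show ?thesis using assms(3) by (metis of_nat_eq_iff)
qed

end
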